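(* For every integer $n \geq 7$, the generalized Petersen graph $GP(n,3)$ has no perfect 2-coloring with the matrix $A_2 = \begin{bmatrix} 2 & 1 \\ 2 & 1 \end{bmatrix}$.
   Context: For integers $n \geq 3$ and $1 \leq k < n/2$, the generalized Petersen graph $GP(n,k)$ is the cubic graph with vertex set $\{a_i, b_i : 0 \leq i \leq n-1\}$ and edge set $\{a_i a_{i+1},\ a_i b_i,\ b_i b_{i+k} : 0 \leq i \leq n-1\}$, with indices taken modulo $n$. For a graph $G$ and an integer $m$, a mapping $T: V(G) \to \{1,\dots,m\}$ is called a perfect $m$-coloring with matrix $A = (a_{ij})_{i,j \in \{1,\dots,m\}}$ if $T$ is surjective and for all $i,j$, every vertex of color $i$ has exactly $a_{ij}$ neighbors of color $j$. (Perfect 2-colorings are considered up to renaming the two colors.) *)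

theory Defs
  imports "Graph_Theory.Pair_Digraph" "Jordan_Normal_Form.Matrix"
begin

text \<open>Undirected graphs are symmetric digraphs, as in the locale \<open>pair_graph\<close>: an edge
  \<open>uv\<close> is the pair of arcs \<open>(u, v)\<close> and \<open>(v, u)\<close>.\<close>

datatype gp_vertex = va nat | vb nat

definition gp_edges :: "nat \<Rightarrow> nat \<Rightarrow> (gp_vertex \<times> gp_vertex) set" where
  "gp_edges n k = (\<Union>i<n. {(va i, va ((i + 1) mod n)), (va i, vb i), (vb i, vb ((i + k) mod n))})"

definition GP :: "nat \<Rightarrow> nat \<Rightarrow> gp_vertex pair_pre_digraph" where
  "GP n k = \<lparr>pverts = (\<Union>i<n. {va i, vb i}), parcs = gp_edges n k \<union> (gp_edges n k)\<inverse>\<rparr>"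

definition neighbors :: "'v pair_pre_digraph \<Rightarrow> 'v \<Rightarrow> 'v set" where
  "neighbors G v = {u \<in> pverts G. (v, u) \<in> parcs G}"

text \<open>Colors are \<open>1, \<dots>, m\<close>, whereas matrix entries are indexed from 0, hence the shift.
  Only the values of \<open>T\<close> on the vertices of \<open>G\<close> matter.\<close>

definition perfect_coloring ::
  "'v pair_pre_digraph \<Rightarrow> nat \<Rightarrow> nat mat \<Rightarrow> ('v \<Rightarrow> nat) \<Rightarrow> bool" where
  "perfect_coloring G m A T \<longleftrightarrow>
     A \<in> carrier_mat m m \<and>
     T ` pverts G = {1..m} \<and>
     (\<forall>i\<in>{1..m}. \<forall>j\<in>{1..m}. \<forall>v\<in>pverts G.
        T v = i \<longrightarrow> card {u \<in> neighbors G v. T u = j} = A $$ (i - 1, j - 1))"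

definition A\<^sub>2 :: "nat mat" where
  "A\<^sub>2 = mat_of_rows_list 2 [[2, 1], [2, 1]]"

lemma shift_mod_neq:
  fixes i k n :: nat
  assumes "i < n" "1 \<le> k" "k < n"
  shows "(i + k) mod n \<noteq> i"
  using assms by (cases "i + k < n") (auto simp: mod_if)

lemma pair_graph_GP:
  assumes "n \<ge> 3" "1 \<le> k" "2 * k < n"
  shows "pair_graph (GP n k)"
proof
  show "finite (pverts (GP n k))" by (auto simp: GP_def)
  show "finite (parcs (GP n k))" by (auto simp: GP_def gp_edges_def)
  show "symmetric (with_proj (GP n k))"
    by (auto simp: symmetric_def GP_def arcs_ends_def arc_to_ends_def sym_def)
next
  fix e assume "e \<in> parcs (GP n k)"
  moreover have "n > 0" using assms by simp
  ultimately show "fst e \<in> pverts (GP n k)" "snd e \<in> pverts (GP n k)"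
    by (auto simp: GP_def gp_edges_def)
next
  fix e assume e: "e \<in> parcs (GP n k)"
  have "(i + 1) mod n \<noteq> i" "(i + k) mod n \<noteq> i" if "i < n" for i
    using shift_mod_neq[OF that, of 1] shift_mod_neq[OF that, of k] assms by auto
  with e show "fst e \<noteq> snd e" unfolding GP_def gp_edges_def by fastforce
qed

lemma shift_mod_eq_iff:
  fixes i j k n :: nat
  assumes "i < n" "j < n" "k \<le> n"
  shows "(j + k) mod n = i \<longleftrightarrow> j = (i + (n - k)) mod n"
  using assms by (auto simp: mod_if)

lemma neighbors_a:
  assumes "n \<ge> 3" "1 \<le> k" "2 * k < n" "i < n"
  shows "neighbors (GP n k) (va i) = {va ((i + 1) mod n), va ((i + (n - 1)) mod n), vb i}"
    and "card (neighbors (GP n k) (va i)) = 3"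
proof -
  show *: "neighbors (GP n k) (va i) = {va ((i + 1) mod n), va ((i + (n - 1)) mod n), vb i}"
  proof -
    let ?p = "(i + (n - 1)) mod n"
    have p: "?p < n" "i = (?p + 1) mod n"
      using assms shift_mod_eq_iff[of i n ?p 1] by simp_all
    have u: "j = ?p" if "j < n" "i = (j + 1) mod n" for j
      using that assms shift_mod_eq_iff[of i n j 1] by simp
    show ?thesis
    proof (intro equalityI subsetI)
      fix v assume "v \<in> neighbors (GP n k) (va i)"
      then show "v \<in> {va ((i + 1) mod n), va ?p, vb i}"
        unfolding neighbors_def GP_def gp_edges_def using u by auto
    next
      fix v assume "v \<in> {va ((i + 1) mod n), va ?p, vb i}"
      moreover have "(va ?p, va i) \<in> gp_edges n k"
        unfolding gp_edges_def using p by blast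
      moreover have "(va i, va ((i + 1) mod n)) \<in> gp_edges n k" "(va i, vb i) \<in> gp_edges n k"
        unfolding gp_edges_def using assms(4) by blast+
      moreover have "(i + 1) mod n < n" using assms by simp
      ultimately show "v \<in> neighbors (GP n k) (va i)"
        using assms(4) p(1) by (auto simp: neighbors_def GP_def)
    qed
  qed
  have "(i + 1) mod n \<noteq> (i + (n - 1)) mod n" using assms by (auto simp: mod_if)
  then show "card (neighbors (GP n k) (va i)) = 3" by (simp add: *)
qed

lemma neighbors_b:
  assumes "n \<ge> 3" "1 \<le> k" "2 * k < n" "i < n"
  shows "neighbors (GP n k) (vb i) = {vb ((i + k) mod n), vb ((i + (n - k)) mod n), va i}"
    and "card (neighbors (GP n k) (vb i)) = 3"
proof -
  show *: "neighbors (GP n k) (vb i) = {vb ((i + k) mod n), vb ((i + (n - k)) mod n), va i}"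
  proof -
    let ?p = "(i + (n - k)) mod n"
    have p: "?p < n" "i = (?p + k) mod n"
      using assms shift_mod_eq_iff[of i n ?p k] by simp_all
    have u: "j = ?p" if "j < n" "i = (j + k) mod n" for j
      using that assms shift_mod_eq_iff[of i n j k] by simp
    show ?thesis
    proof (intro equalityI subsetI)
      fix v assume "v \<in> neighbors (GP n k) (vb i)"
      then show "v \<in> {vb ((i + k) mod n), vb ?p, va i}"
        unfolding neighbors_def GP_def gp_edges_def using u by auto
    next
      fix v assume "v \<in> {vb ((i + k) mod n), vb ?p, va i}"
      moreover have "(vb ?p, vb i) \<in> gp_edges n k"
        unfolding gp_edges_def using p by blast
      moreover have "(vb i, vb ((i + k) mod n)) \<in> gp_edges n k" "(va i, vb i) \<in> gp_edges n k"
        unfolding gp_edges_def using assms(4) by blast+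
      moreover have "(i + k) mod n < n" using assms by simp
      ultimately show "v \<in> neighbors (GP n k) (vb i)"
        using assms(4) p(1) by (auto simp: neighbors_def GP_def)
    qed
  qed
  have "(i + k) mod n \<noteq> (i + (n - k)) mod n" using assms by (auto simp: mod_if)
  then show "card (neighbors (GP n k) (vb i)) = 3" by (simp add: *)
qed

lemma A\<^sub>2_entries:
  "A\<^sub>2 \<in> carrier_mat 2 2"
  "A\<^sub>2 $$ (0, 0) = 2" "A\<^sub>2 $$ (0, 1) = 1" "A\<^sub>2 $$ (1, 0) = 2" "A\<^sub>2 $$ (1, 1) = 1"
  by (simp_all add: A\<^sub>2_def mat_of_rows_list_def numeral_2_eq_2)

end

theory Submission
  imports Defs
begin

text \<open>Both rows of the matrix have second entry 1, so in such a coloring every vertex, whatever its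
  own color, has exactly one neighbor of color 2. Let \<open>x i\<close> and \<open>y i\<close> be the indicators
  of color 2 at \<open>va i\<close> and \<open>vb i\<close>. Then \<open>x (i - 1) + x (i + 1) + y i = 1\<close> and
  \<open>y (i - 3) + y (i + 3) + x i = 1\<close>, with cyclic indices. Eliminating \<open>y\<close> leaves
  \<open>x (i - 4) + x (i - 2) + x (i + 2) + x (i + 4) = 1 + x i\<close>, where also
  \<open>x i + x (i + 2) \<le> 1\<close>. Suppose \<open>x j = 1\<close>. Then \<open>x (j - 2)\<close> and
  \<open>x (j + 2)\<close> vanish, hence \<open>x (j - 4)\<close> and \<open>x (j + 4)\<close> are 1 and
  \<open>x (j + 6)\<close> is 0; now the relation at \<open>j + 2\<close> reads \<open>2 = 1\<close>. So \<open>x\<close> vanishes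
  everywhere, and the relation reads \<open>0 = 1\<close>.

  This argument uses only finitely many consecutive indices, so it works for sequences on the
  natural numbers, obtained by reading indices modulo \<open>n\<close>; that is
  \<open>no_dominating_sequences\<close>.\<close>

lemma no_dominating_sequences:
  fixes x y :: "nat \<Rightarrow> nat"
  assumes outer: "\<And>i. x i + x (i + 2) + y (i + 1) = 1"
    and inner: "\<And>i. y i + y (i + 6) + x (i + 3) = 1"
  shows False
proof -
  have le1: "x i + x (i + 2) \<le> 1" for i
    using outer[of i] by linarith
  have recurrence: "x i + x (i + 2) + x (i + 6) + x (i + 8) = 1 + x (i + 4)" for i
    using outer[of i] outer[of "i + 6"] inner[of "i + 1"] by (simp add: algebra_simps)
  \<comment> \<open>Here \<open>j = i + 4\<close>: the smallest index in the argument is \<open>j - 4\<close>, so on the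
    natural numbers vanishing is obtained from index 4 on.\<close>
  have zero: "x (i + 4) = 0" for i
    using recurrence[of i] recurrence[of "i + 2"]
      le1[of i] le1[of "i + 2"] le1[of "i + 4"] le1[of "i + 6"] le1[of "i + 8"]
    by (simp add: add.assoc del: add_2_eq_Suc add_2_eq_Suc')
  show False
    using recurrence[of 4] zero[of 0] zero[of 2] zero[of 4] zero[of 6] zero[of 8] by simp
qed

lemma card_filter_three:
  assumes "card {p, q, r} = 3"
  shows "card {u \<in> {p, q, r}. P u} = of_bool (P p) + of_bool (P q) + of_bool (P r)"
proof -
  have distinct: "p \<noteq> q" "p \<noteq> r" "q \<noteq> r"
    using assms by (auto simp: card_insert_if split: if_splits)
  have "card {u \<in> {p, q, r}. P u} = (\<Sum>u\<in>{p, q, r}. of_bool (P u))"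
    by (subst sum_of_bool_eq) (auto intro: arg_cong[where f = card])
  then show ?thesis
    using distinct by simp
qed

lemma one_neighbor_of_color_2:
  assumes T: "perfect_coloring G 2 A\<^sub>2 T" and v: "v \<in> pverts G"
  shows "card {u \<in> neighbors G v. T u = 2} = 1"
proof -
  have "T v \<in> {1..2}"
    using T v by (auto simp: perfect_coloring_def)
  moreover from this have "T v = 1 \<or> T v = 2"
    by auto
  moreover have "card {u \<in> neighbors G v. T u = 2} = A\<^sub>2 $$ (T v - 1, 2 - 1)"
    using T v \<open>T v \<in> {1..2}\<close> by (auto simp: perfect_coloring_def)
  ultimately show ?thesis
    using A\<^sub>2_entries by auto
qed

theorem theorem3p2:
  fixes n :: nat
  assumes "n \<ge> 7"
  shows "\<not> (\<exists>T. perfect_coloring (GP n 3) 2 A\<^sub>2 T)"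
proof
  assume "\<exists>T. perfect_coloring (GP n 3) 2 A\<^sub>2 T"
  then obtain T where T: "perfect_coloring (GP n 3) 2 A\<^sub>2 T" ..
  define x y :: "nat \<Rightarrow> nat" where
    "x i = of_bool (T (va (i mod n)) = 2)" and "y i = of_bool (T (vb (i mod n)) = 2)" for i
  have n: "n \<ge> 3" "1 \<le> (3::nat)" "2 * 3 < n"
    using assms by auto
  have verts: "va (i mod n) \<in> pverts (GP n 3)" "vb (i mod n) \<in> pverts (GP n 3)" for i
    using assms by (auto simp: GP_def)
  have shift: "((i + k) mod n + k) mod n = (i + 2 * k) mod n"
    "((i + k) mod n + (n - k)) mod n = i mod n" if "k \<le> n" for i k
    using that by (simp_all add: mod_add_left_eq add.assoc mult_2 del: Nat.add_diff_assoc)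
  show False
  proof (rule no_dominating_sequences)
    fix i
    have lt: "(i + 1) mod n < n" "(i + 3) mod n < n"
      using assms by auto
    show "x i + x (i + 2) + y (i + 1) = 1"
      using one_neighbor_of_color_2[OF T verts(1), of "i + 1"] neighbors_a[OF n lt(1)] shift[of 1 i]
        assms card_filter_three[of "va ((i + 2) mod n)" "va (i mod n)" "vb ((i + 1) mod n)" "\<lambda>u. T u = 2"]
      by (simp add: x_def y_def del: One_nat_def)
    show "y i + y (i + 6) + x (i + 3) = 1"
      using one_neighbor_of_color_2[OF T verts(2), of "i + 3"] neighbors_b[OF n lt(2)] shift[of 3 i]
        assms card_filter_three[of "vb ((i + 6) mod n)" "vb (i mod n)" "va ((i + 3) mod n)" "\<lambda>u. T u = 2"]
      by (simp add: x_def y_def)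
  qed
qed

end
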